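(* Let $\alpha,\beta,r$ be real numbers and let $g(x)=g_{\alpha,\beta}(x)=\mathcal{J}(\alpha,\alpha,\ldots;\beta,\beta,\ldots)$ be a constant coefficient Jacobi continued fraction. Then $$\mathrm{MINVERT}_r(g)(x)=\mathcal{J}(\alpha,\alpha,\alpha,\ldots;\beta+r,\beta,\beta,\ldots).$$
   Context: $\mathcal{J}(\alpha_1,\alpha_2,\ldots;\beta_1,\beta_2,\ldots)$ denotes the formal power series in $x$ given by the Jacobi continued fraction $$\cfrac{1}{1-\alpha_1x-\cfrac{\beta_1x^2}{1-\alpha_2x-\cfrac{\beta_2x^2}{1-\alpha_3x-\cdots}}},$$ understood as the limit of its finite truncations in the $x$-adic topology. The "mean INVERT" transform of a formal power series $g$ is $\mathrm{MINVERT}_r(g)(x)=\frac{g(x)}{1-r\,x^2g(x)^2}$. *)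

theory Defs
  imports "HOL-Computational_Algebra.Formal_Power_Series"
begin

unbundle fps_syntax

text \<open>
  The coefficient sequences are indexed from 1; their values at 0 are irrelevant. The truncation with \<open>n\<close> levels is obtained by replacing the
  \<open>(n + 1)\<close>-st fraction by 0; every denominator has constant coefficient 1.
\<close>

fun J_trunc :: "nat \<Rightarrow> (nat \<Rightarrow> 'a) \<Rightarrow> (nat \<Rightarrow> 'a) \<Rightarrow> 'a::field fps" where
  "J_trunc 0 a b = 0"
| "J_trunc (Suc n) a b =
     1 / (1 - fps_const (a 1) * fps_X
            - fps_const (b 1) * fps_X ^ 2 * J_trunc n (\<lambda>i. a (Suc i)) (\<lambda>i. b (Suc i)))"

text \<open>The topology on \<^typ>\<open>'a fps\<close> is the \<open>x\<close>-adic one.\<close>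

definition J_frac :: "(nat \<Rightarrow> 'a) \<Rightarrow> (nat \<Rightarrow> 'a) \<Rightarrow> 'a::field fps" where
  "J_frac a b = lim (\<lambda>n. J_trunc n a b)"

definition MINVERT :: "'a \<Rightarrow> 'a fps \<Rightarrow> 'a::field fps" where
  "MINVERT r g = g / (1 - fps_const r * fps_X ^ 2 * g ^ 2)"

text \<open>The limit in the definition of \<^const>\<open>J_frac\<close> always exists.\<close>

lemma fps_X_power_dvd_J_trunc_diff: "fps_X ^ n dvd J_trunc n a b - J_trunc (n + k) a b"
proof (induction n arbitrary: a b)
  case 0
  then show ?case by simp
next
  case (Suc n)
  define S where "S = J_trunc n (\<lambda>i. a (Suc i)) (\<lambda>i. b (Suc i))"
  define T where "T = J_trunc (n + k) (\<lambda>i. a (Suc i)) (\<lambda>i. b (Suc i))"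
  define D where "D = 1 - fps_const (a 1) * fps_X - fps_const (b 1) * fps_X ^ 2 * S"
  define E where "E = 1 - fps_const (a 1) * fps_X - fps_const (b 1) * fps_X ^ 2 * T"
  have D: "D $ 0 = 1" and E: "E $ 0 = 1"
    by (simp_all add: D_def E_def)
  have "inverse D - inverse E = inverse D * inverse E * (E - D)"
    using inverse_mult_eq_1[of D] inverse_mult_eq_1[of E] D E
    by (simp add: algebra_simps)
  also have "E - D = fps_const (b 1) * fps_X * (fps_X * (S - T))"
    by (simp add: D_def E_def algebra_simps power2_eq_square)
  finally have eq: "inverse D - inverse E =
    inverse D * inverse E * (fps_const (b 1) * fps_X * (fps_X * (S - T)))" .
  have "fps_X ^ Suc n dvd fps_X * (S - T)"
    using Suc.IH by (simp add: S_def T_def mult_dvd_mono)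
  then have "fps_X ^ Suc n dvd inverse D - inverse E"
    unfolding eq by (rule dvd_mult[OF dvd_mult])
  also have "inverse D - inverse E = J_trunc (Suc n) a b - J_trunc (Suc n + k) a b"
    using D E by (simp add: D_def E_def S_def T_def fps_divide_unit)
  finally show ?case .
qed

lemma J_trunc_tendsto: "(\<lambda>n. J_trunc n a b) \<longlonglongrightarrow> J_frac a b"
proof -
  define L where "L = Abs_fps (\<lambda>i. J_trunc (Suc i) a b $ i)"
  have "(\<lambda>n. J_trunc n a b) \<longlonglongrightarrow> L"
  proof (rule tendsto_fpsI)
    fix i
    show "\<forall>\<^sub>F n in sequentially. J_trunc n a b $ i = L $ i"
      using eventually_ge_at_top[of "Suc i"]
    proof eventually_elim
      case (elim n)
      then obtain k where n: "n = Suc i + k"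
        using le_Suc_ex by blast
      from fps_X_power_dvd_J_trunc_diff[of "Suc i" a b k] obtain h
        where "J_trunc (Suc i) a b - J_trunc n a b = fps_X ^ Suc i * h"
        unfolding n by (elim dvdE)
      then have "(J_trunc (Suc i) a b - J_trunc n a b) $ i = 0"
        by (simp only: fps_X_power_mult_nth) simp
      then show ?case
        by (simp add: L_def del: J_trunc.simps)
    qed
  qed
  then show ?thesis
    unfolding J_frac_def using convergentI convergent_LIMSEQ_iff by blast
qed

end

theory Submission
  imports Defs
begin

text \<open>
  A Jacobi continued fraction satisfies the one-step recursion
  \<open>J = 1 / (1 - \<alpha>\<^sub>1 x - \<beta>\<^sub>1 x\<^sup>2 J')\<close>, where \<open>J'\<close> drops the first level: multiplication is
  continuous for the \<open>x\<close>-adic topology (\<open>tendsto_fps_mult\<close>), so the recursion of the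
  truncations passes to the limit (\<open>J_frac_mult_denominator\<close>).
  For constant coefficients \<open>J' = J = g\<close>, hence \<open>1 / g = 1 - \<alpha> x - \<beta> x\<^sup>2 g\<close>.
  Dividing numerator and denominator of the mean INVERT transform by \<open>g\<close> gives
  \<open>g / (1 - r x\<^sup>2 g\<^sup>2) = 1 / (1 / g - r x\<^sup>2 g) = 1 / (1 - \<alpha> x - (\<beta> + r) x\<^sup>2 g)\<close>,
  and this is the recursion for the continued fraction whose first \<open>\<beta>\<close> is raised by \<open>r\<close> and
  whose tail is \<open>g\<close>.
\<close>

text \<open>
  A coefficient of a product involves only finitely many coefficients of the factors, and each of
  these is eventually constant along an \<open>x\<close>-adically convergent sequence.
\<close>

lemma tendsto_fps_mult:
  fixes F G :: "'a::ring fps"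
  assumes "(f \<longlongrightarrow> F) A" and "(g \<longlongrightarrow> G) A"
  shows "((\<lambda>n. f n * g n) \<longlongrightarrow> F * G) A"
proof (rule tendsto_fpsI)
  fix k
  have "\<forall>\<^sub>F n in A. \<forall>i\<in>{..k}. f n $ i = F $ i"
    using assms(1) by (intro eventually_ball_finite) (auto simp: tendsto_fps_iff)
  moreover have "\<forall>\<^sub>F n in A. \<forall>i\<in>{..k}. g n $ i = G $ i"
    using assms(2) by (intro eventually_ball_finite) (auto simp: tendsto_fps_iff)
  ultimately show "\<forall>\<^sub>F n in A. (f n * g n) $ k = (F * G) $ k"
    by eventually_elim (simp add: fps_mult_nth)
qed

lemma tendsto_fps_diff:
  fixes F G :: "'a::ab_group_add fps"
  assumes "(f \<longlongrightarrow> F) A" and "(g \<longlongrightarrow> G) A"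
  shows "((\<lambda>n. f n - g n) \<longlongrightarrow> F - G) A"
proof (rule tendsto_fpsI)
  fix k
  have "\<forall>\<^sub>F n in A. f n $ k = F $ k" and "\<forall>\<^sub>F n in A. g n $ k = G $ k"
    using assms by (auto simp: tendsto_fps_iff)
  then show "\<forall>\<^sub>F n in A. (f n - g n) $ k = (F - G) $ k"
    by eventually_elim simp
qed

text \<open>
  The shift by one level moves the coefficients with index 1 to index 0. Hence the tails of two
  fractions that differ only in their first level agree from index 1 on, but not at index 0.
\<close>

lemma J_trunc_cong:
  assumes "\<And>i. i \<ge> 1 \<Longrightarrow> a i = a' i" and "\<And>i. i \<ge> 1 \<Longrightarrow> b i = b' i"
  shows "J_trunc n a b = J_trunc n a' b'"
  using assms
proof (induction n arbitrary: a b a' b')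
  case (Suc n)
  have "J_trunc n (\<lambda>i. a (Suc i)) (\<lambda>i. b (Suc i)) = J_trunc n (\<lambda>i. a' (Suc i)) (\<lambda>i. b' (Suc i))"
    using Suc.prems by (intro Suc.IH) simp_all
  then show ?case
    using Suc.prems by simp
qed simp

lemma J_frac_cong:
  assumes "\<And>i. i \<ge> 1 \<Longrightarrow> a i = a' i" and "\<And>i. i \<ge> 1 \<Longrightarrow> b i = b' i"
  shows "J_frac a b = J_frac a' b'"
  unfolding J_frac_def using J_trunc_cong[OF assms] by simp

text \<open>
  The recursion is multiplied out: this form passes to the limit by continuity of ring operations
  alone, without continuity of division.
\<close>

lemma J_frac_mult_denominator:
  "J_frac a b * (1 - fps_const (a 1) * fps_X
     - fps_const (b 1) * fps_X ^ 2 * J_frac (\<lambda>i. a (Suc i)) (\<lambda>i. b (Suc i))) = 1"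
  (is "_ * (?c - ?d * ?J) = 1")
proof (rule LIMSEQ_unique)
  let ?S = "\<lambda>n. J_trunc n (\<lambda>i. a (Suc i)) (\<lambda>i. b (Suc i))"
  show "(\<lambda>n. J_trunc (Suc n) a b * (?c - ?d * ?S n)) \<longlonglongrightarrow> J_frac a b * (?c - ?d * ?J)"
    by (intro tendsto_fps_mult tendsto_fps_diff tendsto_const J_trunc_tendsto
          LIMSEQ_Suc[OF J_trunc_tendsto])
  have "J_trunc (Suc n) a b * (?c - ?d * ?S n) = 1" for n
    by (simp add: fps_divide_unit inverse_mult_eq_1)
  then show "(\<lambda>n. J_trunc (Suc n) a b * (?c - ?d * ?S n)) \<longlonglongrightarrow> 1"
    by (simp only: tendsto_const)
qed

theorem proposition7:
  fixes \<alpha> \<beta> r :: real and g :: "real fps"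
  assumes "g = J_frac (\<lambda>i. \<alpha>) (\<lambda>i. \<beta>)"
  shows "MINVERT r g = J_frac (\<lambda>i. \<alpha>) (\<lambda>i. if i = 1 then \<beta> + r else \<beta>)"
proof -
  let ?h = "J_frac (\<lambda>i. \<alpha>) (\<lambda>i. if i = 1 then \<beta> + r else \<beta>)"
  let ?D = "1 - fps_const \<alpha> * fps_X - fps_const \<beta> * fps_X ^ 2 * g"
  let ?M = "1 - fps_const r * fps_X ^ 2 * g ^ 2"
  have g: "g * ?D = 1"
    using J_frac_mult_denominator[of "\<lambda>i. \<alpha>" "\<lambda>i. \<beta>"] by (simp add: assms)
  have tail: "J_frac (\<lambda>i. \<alpha>) (\<lambda>i. if Suc i = 1 then \<beta> + r else \<beta>) = g"
    unfolding assms by (rule J_frac_cong) simp_all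
  have h: "?h * (1 - fps_const \<alpha> * fps_X - fps_const (\<beta> + r) * fps_X ^ 2 * g) = 1"
    using J_frac_mult_denominator[of "\<lambda>i. \<alpha>" "\<lambda>i. if i = 1 then \<beta> + r else \<beta>"]
    by (simp only: tail simp_thms if_True)
  have "?M = g * ?D - fps_const r * fps_X ^ 2 * g ^ 2"
    by (simp only: g)
  also have "\<dots> = g * (1 - fps_const \<alpha> * fps_X - fps_const (\<beta> + r) * fps_X ^ 2 * g)"
    by (simp add: algebra_simps power2_eq_square flip: fps_const_add)
  finally have "?h * ?M = g"
    using h by (simp only: mult.left_commute mult_1_right)
  moreover have "?M \<noteq> 0"
    by (rule fps_nonzeroI[of _ 0]) simp
  ultimately show ?thesis
    unfolding MINVERT_def by (metis nonzero_mult_div_cancel_right)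
qed

end
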